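(* Let $a_0=0$ and let $(a_n)_{n\ge 1}$ be the increasing sequence of positive integers whose odd part is of the form $4k+1$. Let $d_n=a_{n+1}-a_n$ for $n\ge 0$. Then $(d_n)_{n\ge 0}$ is not $2$-automatic.
   Context: The odd part of a positive integer $m$ is $m/2^v$ with $2^v$ the largest power of $2$ dividing $m$. A sequence $(x_n)_{n\ge0}$ is $2$-automatic if its $2$-kernel $\{(x_{2^in+j})_{n\ge 0} : i\ge 0,\ 0\le j\le 2^i-1\}$ is finite. *)

theory Defs
  imports "HOL-Library.Infinite_Set" "HOL-Computational_Algebra.Primes"
begin

definition odd_part :: "nat \<Rightarrow> nat" where
  "odd_part m = m div 2 ^ multiplicity 2 m"

definition two_kernel :: "(nat \<Rightarrow> 'a) \<Rightarrow> (nat \<Rightarrow> 'a) set" where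
  "two_kernel x = {(\<lambda>n. x (2 ^ i * n + j)) | i j. 0 \<le> j \<and> j \<le> 2 ^ i - 1}"

definition two_automatic :: "(nat \<Rightarrow> 'a) \<Rightarrow> bool" where
  "two_automatic x \<longleftrightarrow> finite (two_kernel x)"

definition A_set :: "nat set" where
  "A_set = {m. m > 0 \<and> (\<exists>k. odd_part m = 4 * k + 1)}"

(* enumerate counts from 0, hence the index shift; see a_seq_characterization. *)
definition a_seq :: "nat \<Rightarrow> nat" where
  "a_seq n = (if n = 0 then 0 else enumerate A_set (n - 1))"

(* The subtraction on nat never truncates, by a_seq_strict_mono. *)
definition d_seq :: "nat \<Rightarrow> nat" where
  "d_seq n = a_seq (n + 1) - a_seq n"

lemma infinite_A_set: "infinite A_set"
proof -
  have "4 * k + 1 \<in> A_set" for k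
  proof -
    have "\<not> 2 dvd 4 * k + 1" by presburger
    then have "multiplicity 2 (4 * k + 1) = 0"
      by (rule not_dvd_imp_multiplicity_0)
    then show ?thesis by (simp add: A_set_def odd_part_def)
  qed
  then have "range (\<lambda>k. 4 * k + 1) \<subseteq> A_set" by blast
  moreover have "infinite (range (\<lambda>k::nat. 4 * k + 1))"
    by (rule range_inj_infinite) (simp add: inj_on_def)
  ultimately show ?thesis using finite_subset by blast
qed

lemma a_seq_strict_mono: "strict_mono a_seq"
unfolding strict_mono_Suc_iff
proof
  fix n
  show "a_seq n < a_seq (Suc n)"
  proof (cases n)
    case 0
    have "enumerate A_set 0 \<in> A_set" by (rule enumerate_in_set[OF infinite_A_set])
    then show ?thesis using 0 by (simp add: a_seq_def A_set_def)
  next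
    case (Suc m)
    then show ?thesis using enumerate_step[OF infinite_A_set, of m] by (simp add: a_seq_def)
  qed
qed

lemma a_seq_characterization: "a_seq 0 = 0" "strict_mono a_seq" "a_seq ` {1..} = A_set"
proof -
  show "a_seq 0 = 0" by (simp add: a_seq_def)
  show "strict_mono a_seq" by (rule a_seq_strict_mono)
  have "a_seq ` {1..} = range (\<lambda>n. a_seq (Suc n))"
  proof (intro set_eqI iffI)
    fix y assume "y \<in> a_seq ` {1..}"
    then obtain n where "n \<ge> 1" "y = a_seq n" by auto
    then have "y = a_seq (Suc (n - 1))" by simp
    then show "y \<in> range (\<lambda>n. a_seq (Suc n))" by blast
  qed auto
  also have "\<dots> = range (enumerate A_set)" by (simp add: a_seq_def)
  also have "\<dots> = A_set" by (rule range_enumerate[OF infinite_A_set])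
  finally show "a_seq ` {1..} = A_set" .
qed

end

theory Submission
  imports Defs
begin

text \<open>
  Write \<open>S\<close> for the set of positive integers with odd part \<open>1\<close> mod \<open>4\<close>. Near a multiple
  \<open>2 ^ (i + 1) * y\<close> the set \<open>S\<close> is a translated copy of its own beginning, but the rank in \<open>S\<close> of that
  multiple is \<open>2 ^ i * y + c\<close>, where \<open>c\<close> takes every natural value as \<open>y\<close> varies. Hence the kernel
  sequence of offset \<open>j\<close> at level \<open>i\<close> takes all the values \<open>d (j - c)\<close>. If the kernel is finite, with
  \<open>K\<close> elements, two offsets in a window of length \<open>K + 1\<close> give the same sequence, so any initial
  segment of \<open>d\<close> has a period \<open>p \<le> K\<close>, and \<open>d\<close> has period \<open>K!\<close>. Then \<open>S + s \<subseteq> S\<close> for some \<open>s > 0\<close>,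
  which fails: if \<open>s \<in> S\<close> then \<open>2s \<in> S\<close> but \<open>3s \<notin> S\<close>, and otherwise \<open>3s \<in> S\<close> but \<open>4s \<notin> S\<close>.
\<close>

lemma power2_mult_odd_in_A_set:
  assumes "odd u"
  shows "2 ^ v * u \<in> A_set \<longleftrightarrow> u mod 4 = 1"
proof -
  have "multiplicity 2 (2 ^ v * u) = v"
    using assms by (intro multiplicity_eqI) auto
  then have "odd_part (2 ^ v * u) = u" by (simp add: odd_part_def)
  moreover have "(\<exists>k. u = 4 * k + 1) \<longleftrightarrow> u mod 4 = 1" by presburger
  ultimately show ?thesis using assms by (auto simp: A_set_def intro: odd_pos)
qed

lemma odd_in_A_set: "odd u \<Longrightarrow> u \<in> A_set \<longleftrightarrow> u mod 4 = 1"
  using power2_mult_odd_in_A_set[of u 0] by simp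

lemma zero_notin_A_set: "0 \<notin> A_set"
  by (simp add: A_set_def)

lemma pos_nat_power2_odd:
  fixes m :: nat
  assumes "m > 0"
  obtains v u where "m = 2 ^ v * u" "odd u"
proof -
  have "\<exists>u. m = 2 ^ multiplicity 2 m * u \<and> odd u"
    using multiplicity_decompose'[of m 2] assms by auto
  then show ?thesis using that by blast
qed

lemma double_in_A_set: "2 * m \<in> A_set \<longleftrightarrow> m \<in> A_set"
proof (cases "m = 0")
  case False
  then obtain v u where "m = 2 ^ v * u" "odd u" by (auto intro: pos_nat_power2_odd)
  then show ?thesis
    using power2_mult_odd_in_A_set[of u v] power2_mult_odd_in_A_set[of u "Suc v"]
    by (simp add: mult.assoc)
qed simp

text \<open>As \<open>0 < m < 2 ^ i\<close>, the power of 2 dividing \<open>m\<close> is at most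
  \<open>2 ^ (i - 1)\<close>, so the added multiple changes the odd part by a multiple of 4.\<close>

lemma translate_in_A_set:
  assumes "0 < m" "m < 2 ^ i"
  shows "2 ^ Suc i * y + m \<in> A_set \<longleftrightarrow> m \<in> A_set"
  using assms
proof (induction i arbitrary: m)
  case (Suc i)
  show ?case
  proof (cases "even m")
    case True
    then obtain k where k: "m = 2 * k" by (elim evenE)
    have "2 ^ Suc (Suc i) * y + m = 2 * (2 ^ Suc i * y + k)" by (simp add: k)
    then show ?thesis using Suc k by (simp only: double_in_A_set) simp
  next
    case False
    have "(2 ^ Suc (Suc i) * y + m) mod 4 = m mod 4"
      using mod_mult_self2[of m 4 "2 ^ i * y"] by (simp add: ac_simps)
    moreover have "odd (2 ^ Suc (Suc i) * y + m)" using False by simp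
    ultimately show ?thesis using False odd_in_A_set by metis
  qed
qed simp

lemma A_set_not_translation_closed:
  assumes "s > 0"
  obtains m where "m \<in> A_set" "m + s \<notin> A_set"
proof -
  obtain v u where s: "s = 2 ^ v * u" "odd u"
    using assms by (auto intro: pos_nat_power2_odd)
  have s_iff: "s \<in> A_set \<longleftrightarrow> u mod 4 = 1"
    using s power2_mult_odd_in_A_set by simp
  have "s * 3 \<in> A_set \<longleftrightarrow> (u * 3) mod 4 = 1"
    using s power2_mult_odd_in_A_set[of "u * 3" v] by (simp add: ac_simps)
  then have triple: "s * 3 \<in> A_set \<longleftrightarrow> s \<notin> A_set"
    using s(2) unfolding s_iff by presburger
  show ?thesis
  proof (cases "s \<in> A_set")
    case True
    then have "2 * s \<in> A_set" "2 * s + s \<notin> A_set"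
      using triple by (simp_all only: double_in_A_set) (simp add: mult.commute)
    then show ?thesis by (rule that)
  next
    case False
    then have "2 * (2 * s) \<notin> A_set" by (simp only: double_in_A_set simp_thms)
    then have "s * 3 + s \<notin> A_set" by (simp add: mult.commute)
    then show ?thesis using False triple that by blast
  qed
qed

text \<open>The rank function of \<open>A_set\<close>; on \<open>A_set\<close> it inverts
  \<open>a_seq\<close>.\<close>

definition A_count :: "nat \<Rightarrow> nat" where
  "A_count N = card (A_set \<inter> {..N})"

lemma A_count_0: "A_count 0 = 0"
  using zero_notin_A_set by (simp add: A_count_def)

lemma A_count_Suc: "A_count (Suc N) = A_count N + (if Suc N \<in> A_set then 1 else 0)"
  by (simp add: A_count_def atMost_Suc)

lemma A_count_a_seq: "A_count (a_seq n) = n"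
proof -
  have mono: "a_seq k \<le> a_seq n \<longleftrightarrow> k \<le> n" for k
    by (rule strict_mono_less_eq[OF a_seq_strict_mono])
  have "A_set \<inter> {..a_seq n} = a_seq ` {1..n}"
    unfolding a_seq_characterization(3)[symmetric] by (auto simp: mono)
  moreover have "inj_on a_seq {1..n}"
    using strict_mono_imp_inj_on[OF a_seq_strict_mono] subset_UNIV by (rule inj_on_subset)
  ultimately show ?thesis by (simp add: A_count_def card_image)
qed

lemma a_seq_A_count:
  assumes "m \<in> A_set"
  shows "a_seq (A_count m) = m"
proof -
  obtain n where "m = a_seq n"
    using assms unfolding a_seq_characterization(3)[symmetric] by blast
  then show ?thesis by (simp add: A_count_a_seq)
qed

lemma a_seq_in_A_set: "n \<ge> 1 \<Longrightarrow> a_seq n \<in> A_set"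
  unfolding a_seq_characterization(3)[symmetric] by simp

lemma A_count_odd: "A_count (2 * N + 1) = A_count (2 * N) + (if even N then 1 else 0)"
proof -
  have "2 * N + 1 \<in> A_set \<longleftrightarrow> (2 * N + 1) mod 4 = 1" by (rule odd_in_A_set) simp
  also have "\<dots> \<longleftrightarrow> even N" by presburger
  finally show ?thesis using A_count_Suc[of "2 * N"] by simp
qed

text \<open>The even members up to \<open>2 * N\<close> are the doubles of the members up to
  \<open>N\<close>; the odd ones are the numbers 1 mod 4, and there are \<open>(N + 1) div 2\<close>
  of them.\<close>

lemma A_count_double: "A_count (2 * N) = A_count N + (N + 1) div 2"
proof (induction N)
  case (Suc N)
  have "A_count (2 * Suc N) = A_count (2 * N + 1) + (if Suc N \<in> A_set then 1 else 0)"
    using A_count_Suc[of "2 * N + 1"] double_in_A_set[of "Suc N"] by simp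
  also have "\<dots> = A_count (Suc N) + (Suc N + 1) div 2"
    unfolding A_count_odd Suc A_count_Suc by simp
  finally show ?case .
qed (simp add: A_count_0)

lemma ex_A_count_excess: "\<exists>y. A_count (2 * y) = y + c"
proof (induction c)
  case 0
  show ?case by (rule exI[of _ 0]) (simp add: A_count_0)
next
  case (Suc c)
  then obtain y where "A_count (2 * y) = y + c" ..
  \<comment> \<open>Passing from \<open>y\<close> to \<open>4 * y + 1\<close>, that is, appending 01
    in binary, raises the excess by one.\<close>
  then have "A_count (2 * (2 * (2 * y) + 1)) = (2 * (2 * y) + 1) + Suc c"
    by (simp only: A_count_double[of "2 * (2 * y) + 1"] A_count_odd A_count_double[of "2 * y"]) simp
  then show ?case ..
qed

text \<open>Doubling an even argument \<open>N\<close> adds exactly \<open>N div 2\<close> to the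
  rank, so the excess \<open>c\<close> survives at every level.\<close>

lemma A_count_power2_excess:
  assumes "A_count (2 * y) = y + c"
  shows "A_count (2 ^ Suc i * y) = 2 ^ i * y + c"
proof (induction i)
  case (Suc i)
  have "A_count (2 ^ Suc (Suc i) * y) = A_count (2 * (2 ^ Suc i * y))"
    by (simp only: power_Suc mult.assoc)
  also have "\<dots> = 2 ^ Suc i * y + c"
    unfolding A_count_double Suc by simp
  finally show ?case .
qed (use assms in simp)

lemma A_count_translate:
  "m < 2 ^ i \<Longrightarrow> A_count (2 ^ Suc i * y + m) = A_count (2 ^ Suc i * y) + A_count m"
proof (induction m)
  case (Suc m)
  then show ?case
    using translate_in_A_set[of "Suc m" i y] by (simp add: A_count_Suc)
qed (simp add: A_count_0)

lemma a_seq_translate: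
  assumes "A_count (2 * y) = y + c" "t \<ge> 1" "a_seq t < 2 ^ i"
  shows "a_seq (2 ^ i * y + (c + t)) = 2 ^ Suc i * y + a_seq t"
proof -
  have "a_seq t \<in> A_set" using assms by (intro a_seq_in_A_set)
  then have "2 ^ Suc i * y + a_seq t \<in> A_set"
    using translate_in_A_set assms(3) zero_notin_A_set by (metis gr0I)
  moreover have "A_count (2 ^ Suc i * y + a_seq t) = 2 ^ i * y + (c + t)"
    using assms by (simp only: A_count_translate A_count_power2_excess A_count_a_seq add.assoc)
  ultimately show ?thesis using a_seq_A_count by metis
qed

text \<open>The gap at \<open>t\<close> lies between two consecutive members, so both must fall in
  the range below \<open>2 ^ i\<close> that is copied; \<open>t = 0\<close> is excluded because
  \<open>a_seq 0\<close> is not in \<open>A_set\<close>.\<close>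

lemma d_seq_translate:
  assumes "A_count (2 * y) = y + c" "t \<ge> 1" "a_seq (t + 1) < 2 ^ i"
  shows "d_seq (2 ^ i * y + (c + t)) = d_seq t"
proof -
  have "a_seq t < 2 ^ i"
    using assms(3) strict_monoD[OF a_seq_strict_mono, of t "t + 1"] by simp
  then show ?thesis
    using a_seq_translate[OF assms(1,2)] a_seq_translate[OF assms(1) _ assms(3)]
    by (simp add: d_seq_def add.assoc)
qed

text \<open>The bound on \<open>p\<close> is independent of \<open>M\<close>, which later gives one
  period common to all prefixes.\<close>

lemma d_seq_prefix_period:
  assumes "two_automatic d_seq"
  obtains p where "0 < p" "p \<le> card (two_kernel d_seq)"
    "\<And>t. 1 \<le> t \<Longrightarrow> t \<le> M \<Longrightarrow> d_seq (t + p) = d_seq t"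
proof -
  let ?K = "card (two_kernel d_seq)"
  \<comment> \<open>A crude level, large enough that \<open>2 ^ i\<close> exceeds every term of
    \<open>a_seq\<close> that occurs below.\<close>
  define i where "i = a_seq (M + ?K + 1)"
  define F where "F j = (\<lambda>n. d_seq (2 ^ i * n + j))" for j
  have a_less: "a_seq (t + 1) < 2 ^ i" if "t \<le> M + ?K" for t
  proof -
    have "a_seq (t + 1) \<le> i"
      unfolding i_def using that strict_mono_less_eq[OF a_seq_strict_mono] by simp
    then show ?thesis using less_exp[of i] by linarith
  qed
  have F_kernel: "F j \<in> two_kernel d_seq" if "j \<le> M + ?K" for j
  proof -
    have "j \<le> 2 ^ i - 1"
      using a_less[OF that] strict_mono_imp_increasing[OF a_seq_strict_mono, of "j + 1"] by linarith
    then show ?thesis unfolding two_kernel_def F_def by blast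
  qed
  have "card (F ` {M..M + ?K}) \<le> ?K"
    using assms F_kernel by (intro card_mono) (auto simp: two_automatic_def)
  then have "\<not> inj_on F {M..M + ?K}"
    by (intro pigeonhole) simp
  then obtain j j' where jj: "F j = F j'" "M \<le> j" "j < j'" "j' \<le> M + ?K"
    using linorder_inj_onI'[of "{M..M + ?K}" F] by auto
  show ?thesis
  proof
    show "0 < j' - j" "j' - j \<le> ?K" using jj by auto
    fix t assume t: "1 \<le> t" "t \<le> M"
    \<comment> \<open>With excess \<open>j - t\<close>, the offsets \<open>j\<close> and
      \<open>j'\<close> land on the copies of \<open>t\<close> and \<open>t + (j' - j)\<close>. The
      window starts at \<open>M\<close>, so \<open>j - t\<close> does not truncate.\<close>
    obtain y where y: "A_count (2 * y) = y + (j - t)" using ex_A_count_excess by blast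
    have "d_seq (2 ^ i * y + (j - t + t)) = d_seq t"
      using y t a_less[of t] by (intro d_seq_translate) auto
    moreover have "d_seq (2 ^ i * y + (j - t + (t + (j' - j)))) = d_seq (t + (j' - j))"
      using y t jj a_less[of "t + (j' - j)"] by (intro d_seq_translate) auto
    moreover have "j - t + t = j" "j - t + (t + (j' - j)) = j'" using jj t by auto
    ultimately show "d_seq (t + (j' - j)) = d_seq t"
      using fun_cong[OF jj(1), of y] by (simp add: F_def)
  qed
qed

lemma d_seq_period:
  assumes "two_automatic d_seq"
  obtains P where "P > 0" "\<And>t. t \<ge> 1 \<Longrightarrow> d_seq (t + P) = d_seq t"
proof
  let ?P = "fact (card (two_kernel d_seq)) :: nat"
  show "?P > 0" by simp
  fix t :: nat assume t: "t \<ge> 1"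
  \<comment> \<open>The prefix is long enough to contain all steps of length \<open>p\<close> from
    \<open>t\<close> to \<open>t + ?P\<close>.\<close>
  obtain p where p: "0 < p" "p \<le> card (two_kernel d_seq)"
    "\<And>r. 1 \<le> r \<Longrightarrow> r \<le> t + ?P \<Longrightarrow> d_seq (r + p) = d_seq r"
    using d_seq_prefix_period[OF assms] by blast
  have "p dvd ?P" using p by (intro dvd_fact) auto
  then obtain q where q: "?P = p * q" ..
  have "k \<le> q \<Longrightarrow> d_seq (t + p * k) = d_seq t" for k
  proof (induction k)
    case (Suc k)
    have "p * k \<le> ?P" unfolding q using Suc by (intro mult_le_mono2) simp
    then show ?case using p(3)[of "t + p * k"] Suc t by (simp add: ac_simps)
  qed simp
  then show "d_seq (t + ?P) = d_seq t" by (simp add: q)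
qed

theorem theorem10:
  shows "\<not> two_automatic d_seq"
proof
  assume "two_automatic d_seq"
  then obtain P where P: "P > 0" "\<And>t. t \<ge> 1 \<Longrightarrow> d_seq (t + P) = d_seq t"
    using d_seq_period by blast
  \<comment> \<open>The sum of the gaps over one period, taken from index 1 because periodicity is
    only known from there.\<close>
  define s where "s = a_seq (1 + P) - a_seq 1"
  have a_Suc: "a_seq (Suc n) = a_seq n + d_seq n" for n
    using strict_monoD[OF a_seq_strict_mono, of n "Suc n"] by (simp add: d_seq_def)
  have less: "a_seq 1 < a_seq (1 + P)"
    using P(1) strict_monoD[OF a_seq_strict_mono] by simp
  have a_shift: "a_seq (n + P) = a_seq n + s" if "n \<ge> 1" for n
    using that
  proof (induction n rule: nat_induct_at_least)
    case base
    then show ?case using less by (simp add: s_def)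
  next
    case (Suc n)
    then show ?case using a_Suc[of n] a_Suc[of "n + P"] P(2)[of n] by simp
  qed
  have "m + s \<in> A_set" if m: "m \<in> A_set" for m
  proof -
    obtain n where "n \<ge> 1" "m = a_seq n"
      using m unfolding a_seq_characterization(3)[symmetric] by auto
    then show ?thesis using a_shift[of n] a_seq_in_A_set[of "n + P"] by simp
  qed
  moreover have "s > 0" using less by (simp add: s_def)
  ultimately show False using A_set_not_translation_closed by metis
qed

end
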